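(* Let $f=(f_k)_{k\ge 1}$ be a parameter of association with Properties 1 and 4. Then for every $k\ge 1$ and every distribution $(p(t):t\in T_k)$ on $T_k=\{1,2\}^k$, $$\operatorname{sgn}\bigl(f_k(p(t):t\in T_k)\bigr)=\operatorname{sgn}\bigl(LOR_k(p(t):t\in T_k)\bigr),$$ that is, $f_k$ assigns the same direction of association to all distributions as $LOR_k$ does; and, therefore, $f$ is not directionally collapsible (Property 3 does not hold for $f$).
   Context: A distribution on $T_k=\{1,2\}^k$ (the table of the binary variables $V_1,\dots,V_k$) is any family $(p(t):t\in T_k)$ of strictly positive real numbers (not necessarily summing to $1$). A parameter of association is given by real-valued functions $f_k$ on the set of distributions on $T_k$, one for each $k\ge1$; Properties 1 and 4 are required for every $k\ge 1$. Here $\operatorname{sgn}$ takes values in $\{-1,0,1\}$. Property 1: $f_k$ is continuous, $f_k(p(t):t\in T_k)=0$ if $p(t)=c$ for all $t\in T_k$ (for any constant $c>0$), and $f_k$ is strictly increasing in the entry $p(1,1,\ldots,1)$ (the other entries being fixed). Property 4 (dependence on the conditional distributions only): if two distributions $p$ and $q$ on $T_k$ are such that there is an $i\in\{1,\ldots,k\}$ for which the conditional distributions of $V_i$ given the categories of all other variables coincide, i.e. $$\frac{p(j_1,\ldots,j_{i-1},1,j_{i+1},\ldots,j_k)}{p(j_1,\ldots,j_{i-1},+,j_{i+1},\ldots,j_k)}=\frac{q(j_1,\ldots,j_{i-1},1,j_{i+1},\ldots,j_k)}{q(j_1,\ldots,j_{i-1},+,j_{i+1},\ldots,j_k)}$$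 for all values of the other indices ($+$ denotes summation over that index), then $f_k(p)=f_k(q)$. Property 3 (directional collapsibility): for every $k\ge 2$, every distribution $p$ on $T_k$ and every $i\in\{1,\ldots,k\}$, if $$\operatorname{sgn} f_{k-1}(p(t):t\in T_{k-1}(V_i=1))=\operatorname{sgn} f_{k-1}(p(t):t\in T_{k-1}(V_i=2)),$$ then $\operatorname{sgn} f_{k-1}(p(t):t\in T_{k-1}(V_i=+))$ is equal to this common value. Here $T_{k-1}(V_i=j)$ is the $(k-1)$-dimensional table of the variables other than $V_i$ consisting of the cells of $T_k$ with $i$-th index $j$ (with the entries of $p$ in these cells), and $T_{k-1}(V_i=+)$ is the table obtained by collapsing (marginalizing) over $V_i$, i.e. its entries are the sums of the corresponding entries for $V_i=1$ and $V_i=2$. $LOR_k(p)=\sum_{t\in T_{ke}}\log p(t)-\sum_{t\in T_{ko}}\log p(t)$, where $T_{ke}$ (resp. $T_{ko}$) is the set of cells $t\in T_k$ with an even (resp. odd) number of coordinates equal to $2$. *)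

theory Defs
  imports "HOL-Analysis.Analysis"
begin

definition cells :: "nat \<Rightarrow> nat list set" where
  "cells k = {t. set t \<subseteq> {1, 2} \<and> length t = k}"

text \<open>
  Distributions are extensional functions (\<open>undefined\<close> outside the table), so that a function on
  \<open>dists k\<close> depends on the cell entries only, and the product topology restricted to \<open>dists k\<close>
  is the usual topology of the positive orthant.
\<close>
definition dists :: "nat \<Rightarrow> (nat list \<Rightarrow> real) set" where
  "dists k = (cells k \<rightarrow>\<^sub>E {0<..})"

text \<open>
  Variables are numbered from 0. \<open>ins i j s\<close> is the cell whose coordinate \<open>i\<close> is \<open>j\<close> and whose
  other coordinates are those of \<open>s\<close>, in order.
\<close>
definition ins :: "nat \<Rightarrow> nat \<Rightarrow> nat list \<Rightarrow> nat list" where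
  "ins i j s = take i s @ j # drop i s"

text \<open>
  Both operations below take a distribution on \<open>cells k\<close> to one on \<open>cells (k - 1)\<close>, for
  \<open>i < k\<close> and \<open>j \<in> {1, 2}\<close>.
\<close>
definition slice_table :: "nat \<Rightarrow> nat \<Rightarrow> nat \<Rightarrow> (nat list \<Rightarrow> real) \<Rightarrow> nat list \<Rightarrow> real" where
  "slice_table k i j p = (\<lambda>s\<in>cells (k - 1). p (ins i j s))"

definition marginal_table :: "nat \<Rightarrow> nat \<Rightarrow> (nat list \<Rightarrow> real) \<Rightarrow> nat list \<Rightarrow> real" where
  "marginal_table k i p = (\<lambda>s\<in>cells (k - 1). p (ins i 1 s) + p (ins i 2 s))"

definition same_conditional ::
    "nat \<Rightarrow> nat \<Rightarrow> (nat list \<Rightarrow> real) \<Rightarrow> (nat list \<Rightarrow> real) \<Rightarrow> bool" where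
  "same_conditional k i p q \<longleftrightarrow>
     (\<forall>s\<in>cells (k - 1).
        p (ins i 1 s) / (p (ins i 1 s) + p (ins i 2 s)) =
        q (ins i 1 s) / (q (ins i 1 s) + q (ins i 2 s)))"

text \<open>
  A parameter of association is a sequence \<open>f\<close> in which only the values of \<open>f k\<close> on \<open>dists k\<close>
  for \<open>k \<ge> 1\<close> are relevant.
\<close>
definition property1 :: "(nat \<Rightarrow> (nat list \<Rightarrow> real) \<Rightarrow> real) \<Rightarrow> bool" where
  "property1 f \<longleftrightarrow>
     (\<forall>k\<ge>1.
        continuous_on (dists k) (f k) \<and>
        (\<forall>c>0. f k (\<lambda>t\<in>cells k. c) = 0) \<and>
        (\<forall>p\<in>dists k. \<forall>x > p (replicate k 1). f k p < f k (p(replicate k 1 := x))))"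

definition property3 :: "(nat \<Rightarrow> (nat list \<Rightarrow> real) \<Rightarrow> real) \<Rightarrow> bool" where
  "property3 f \<longleftrightarrow>
     (\<forall>k\<ge>2. \<forall>p\<in>dists k. \<forall>i<k.
        sgn (f (k - 1) (slice_table k i 1 p)) = sgn (f (k - 1) (slice_table k i 2 p)) \<longrightarrow>
        sgn (f (k - 1) (marginal_table k i p)) = sgn (f (k - 1) (slice_table k i 1 p)))"

definition property4 :: "(nat \<Rightarrow> (nat list \<Rightarrow> real) \<Rightarrow> real) \<Rightarrow> bool" where
  "property4 f \<longleftrightarrow>
     (\<forall>k\<ge>1. \<forall>p\<in>dists k. \<forall>q\<in>dists k.
        (\<exists>i<k. same_conditional k i p q) \<longrightarrow> f k p = f k q)"

definition even_cells :: "nat \<Rightarrow> nat list set" where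
  "even_cells k = {t \<in> cells k. even (count_list t 2)}"

definition odd_cells :: "nat \<Rightarrow> nat list set" where
  "odd_cells k = {t \<in> cells k. odd (count_list t 2)}"

definition LOR :: "nat \<Rightarrow> (nat list \<Rightarrow> real) \<Rightarrow> real" where
  "LOR k p = (\<Sum>t\<in>even_cells k. ln (p t)) - (\<Sum>t\<in>odd_cells k. ln (p t))"

end

theory Submission imports Defs begin

text \<open>
  The heart of the matter is that the distributions on a \<open>k\<close>-way binary table, taken modulo equality
  of a full conditional, form a one-parameter family, and that \<open>LOR k\<close> is the parameter. Multiplying
  the entries of two cells that differ in a single coordinate by a common positive factor keeps a
  full conditional distribution, hence does not change \<open>f k\<close>. Such rescalings can replace the entry
  of any cell by \<open>1\<close> at the cost of a factor at a neighbouring cell, and walking from neighbour to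
  neighbour all these factors can be collected in the cell \<open>(1, \<dots>, 1)\<close>. So every distribution can
  be moved to one that is \<open>1\<close> everywhere except for some entry \<open>y\<close> at \<open>(1, \<dots>, 1)\<close>
  (\<open>rescaling_normal_form\<close>). For this distribution, monotonicity in the entry \<open>y\<close> and the value
  \<open>0\<close> at the constant table give \<open>f k\<close> the sign of \<open>y - 1\<close>. But \<open>LOR k\<close> is invariant under the
  same rescalings, because neighbouring cells enter it with opposite signs, and it equals \<open>ln y\<close>
  on the normal form; so both signs agree (\<open>sgn_eq_sgn_LOR\<close>).

  Directional collapsibility now fails for \<open>f\<close> because it fails for the log odds ratio of a
  \<open>2 \<times> 2\<close> table: this is Simpson's paradox. The two tables \<open>(3, 8; 1, 3)\<close> and \<open>(3, 1; 8, 3)\<close> have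
  \<open>3 * 3 > 8 * 1\<close>, while their sum \<open>(6, 9; 9, 6)\<close> has \<open>6 * 6 < 9 * 9\<close>. (One variable fewer would
  not suffice: two numbers that exceed two others have the larger sum.)
\<close>

section \<open>Cells and distributions\<close>

lemma finite_cells [simp]: "finite (cells k)"
  unfolding cells_def by (rule finite_lists_length_eq) simp

lemma replicate_in_cells [simp]: "replicate k 1 \<in> cells k" "replicate k (Suc 0) \<in> cells k"
  by (auto simp: cells_def)

lemma ins_in_cells:
  assumes "i < k" "s \<in> cells (k - 1)" "j \<in> {1, 2}"
  shows "ins i j s \<in> cells k"
  using assms by (auto simp: cells_def ins_def dest: in_set_takeD in_set_dropD)

lemma ins_eq_iff:
  assumes "length s = length s'" "i \<le> length s"
  shows "ins i j s = ins i j' s' \<longleftrightarrow> j = j' \<and> s = s'"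
  using assms by (auto simp: ins_def) (metis append_take_drop_id)

lemma count_list_ins: "count_list (ins i j s) x = count_list s x + (if j = x then 1 else 0)"
proof -
  have "count_list s x = count_list (take i s) x + count_list (drop i s) x"
    by (metis append_take_drop_id count_list_append)
  then show ?thesis by (simp add: ins_def)
qed

lemma cell_without_2:
  assumes "t \<in> cells k" "count_list t 2 = 0"
  shows "t = replicate k 1"
  using assms by (auto simp: cells_def count_list_0_iff intro!: replicate_eqI)

lemma cell_with_2:
  assumes "t \<in> cells k" "count_list t 2 > 0"
  obtains i s where "i < k" "s \<in> cells (k - 1)" "t = ins i 2 s"
proof -
  from assms(2) have "2 \<in> set t" by (metis count_list_0_iff less_irrefl)
  then obtain xs ys where t: "t = xs @ 2 # ys" by (meson split_list)
  show thesis
  proof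
    show "length xs < k" "xs @ ys \<in> cells (k - 1)" "t = ins (length xs) 2 (xs @ ys)"
      using assms(1) t by (auto simp: cells_def ins_def)
  qed
qed

lemma dists_pos: "p \<in> dists k \<Longrightarrow> t \<in> cells k \<Longrightarrow> p t > 0"
  by (auto simp: dists_def dest: PiE_mem)

lemma dists_upd: "p \<in> dists k \<Longrightarrow> t \<in> cells k \<Longrightarrow> x > 0 \<Longrightarrow> p(t := x) \<in> dists k"
  by (auto simp: dists_def PiE_iff extensional_def)

lemma restrict_in_dists: "(\<And>t. t \<in> cells k \<Longrightarrow> p t > 0) \<Longrightarrow> restrict p (cells k) \<in> dists k"
  by (auto simp: dists_def)

section \<open>Rescaling neighbouring cells\<close>

definition rescaling_invariant :: "nat \<Rightarrow> ((nat list \<Rightarrow> real) \<Rightarrow> real) \<Rightarrow> bool" where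
  "rescaling_invariant k g \<longleftrightarrow>
     (\<forall>p\<in>dists k. \<forall>i<k. \<forall>s\<in>cells (k - 1). \<forall>c>0.
        g (p(ins i 1 s := c * p (ins i 1 s), ins i 2 s := c * p (ins i 2 s))) = g p)"

text \<open>
  The conditional distribution of a variable only involves ratios within pairs of cells that
  differ in this variable, and a common factor cancels from them.
\<close>
lemma property4_imp_rescaling_invariant:
  assumes "property4 f" "k \<ge> 1"
  shows "rescaling_invariant k (f k)"
  unfolding rescaling_invariant_def
proof (intro ballI allI impI)
  fix p i s and c :: real
  assume p: "p \<in> dists k" and i: "i < k" and s: "s \<in> cells (k - 1)" and c: "c > 0"
  let ?q = "p(ins i 1 s := c * p (ins i 1 s), ins i 2 s := c * p (ins i 2 s))"
  have t: "ins i 1 s \<in> cells k" "ins i 2 s \<in> cells k"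
    using ins_in_cells[OF i s] by auto
  have q: "?q \<in> dists k"
    using p t c by (intro dists_upd mult_pos_pos dists_pos[OF p])
  have "same_conditional k i ?q p"
    unfolding same_conditional_def
  proof
    fix s' assume s': "s' \<in> cells (k - 1)"
    have "ins i j s' = ins i j' s \<longleftrightarrow> j = j' \<and> s' = s" for j j'
      using s s' i by (intro ins_eq_iff) (auto simp: cells_def)
    then show "?q (ins i 1 s') / (?q (ins i 1 s') + ?q (ins i 2 s')) =
               p (ins i 1 s') / (p (ins i 1 s') + p (ins i 2 s'))"
      using c by (auto simp flip: distrib_left)
  qed
  then show "f k ?q = f k p"
    using assms p q i unfolding property4_def by blast
qed

text \<open>
  A factor at one cell acts like some factor at \<open>(1, \<dots>, 1)\<close>: rescaling a pair of neighbours by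
  \<open>1 / c\<close> turns a factor \<open>c\<close> at the cell with a \<open>2\<close> into a factor \<open>1 / c\<close> at the cell with that
  \<open>2\<close> replaced by \<open>1\<close>, and finitely many of these steps remove every \<open>2\<close>. The factor \<open>d\<close> does not
  depend on the invariant function, which is what allows comparing two invariant functions later.
\<close>
lemma move_factor_to_ones:
  assumes "t \<in> cells k" "c > 0"
  shows "\<exists>d>0. \<forall>p\<in>dists k. \<forall>g. rescaling_invariant k g \<longrightarrow>
           g (p(t := c * p t)) = g (p(replicate k 1 := d * p (replicate k 1)))"
  using assms
proof (induction "count_list t 2" arbitrary: t c)
  case 0
  then have "t = replicate k 1" by (metis cell_without_2)
  with 0 show ?case by blast
next
  case (Suc n)
  then obtain i s where i: "i < k" and s: "s \<in> cells (k - 1)" and t: "t = ins i 2 s"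
    by (metis cell_with_2 zero_less_Suc)
  define t' where "t' = ins i 1 s"
  have t': "t' \<in> cells k" using i s by (simp add: t'_def ins_in_cells)
  have "n = count_list t' 2"
    using Suc.hyps(2) by (simp add: t t'_def count_list_ins)
  with Suc.hyps(1) t' Suc.prems(2) obtain d where d: "d > 0" and
    move: "\<And>p g. p \<in> dists k \<Longrightarrow> rescaling_invariant k g \<Longrightarrow>
             g (p(t' := 1 / c * p t')) = g (p(replicate k 1 := d * p (replicate k 1)))"
    by (metis zero_less_divide_1_iff)
  have "t' \<noteq> t"
    using ins_eq_iff[of s s i 1 2] i s by (auto simp: t t'_def cells_def)
  show ?case
  proof (intro exI conjI ballI allI impI)
    fix p g assume p: "p \<in> dists k" and g: "rescaling_invariant k g"
    let ?q = "p(t := c * p t)"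
    have q: "?q \<in> dists k"
      using p Suc.prems by (intro dists_upd mult_pos_pos dists_pos[OF p])
    have "g ?q = g (?q(t' := 1 / c * ?q t', t := 1 / c * ?q t))"
      using g q i s Suc.prems(2) unfolding rescaling_invariant_def t t'_def
      by (metis zero_less_divide_1_iff)
    also have "?q(t' := 1 / c * ?q t', t := 1 / c * ?q t) = p(t' := 1 / c * p t')"
      using Suc.prems(2) \<open>t' \<noteq> t\<close> by (auto simp: fun_eq_iff)
    finally show "g ?q = g (p(replicate k 1 := d * p (replicate k 1)))"
      using move[OF p g] by (rule trans)
  qed (fact d)
qed

definition normal_table :: "nat \<Rightarrow> real \<Rightarrow> nat list \<Rightarrow> real" where
  "normal_table k y = (\<lambda>t\<in>cells k. 1)(replicate k 1 := y)"

text \<open>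
  The cells where \<open>p\<close> differs from \<open>1\<close> are treated one by one: moving the factor \<open>p a\<close> from
  such a cell \<open>a\<close> to \<open>(1, \<dots>, 1)\<close> leaves the entry \<open>1\<close> at \<open>a\<close> and disturbs no cell treated before.
\<close>
lemma rescaling_normal_form:
  assumes "p \<in> dists k"
  shows "\<exists>y>0. \<forall>g. rescaling_invariant k g \<longrightarrow> g p = g (normal_table k y)"
proof -
  let ?u = "replicate k 1 :: nat list"
  have "\<exists>y>0. \<forall>g. rescaling_invariant k g \<longrightarrow> g p = g (normal_table k y)"
    if "finite A" "A \<subseteq> cells k" "?u \<notin> A" "p \<in> dists k"
      "\<forall>t\<in>cells k. t \<notin> insert ?u A \<longrightarrow> p t = 1" for A p
    using that
  proof (induction A arbitrary: p)
    case empty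
    then have "p = normal_table k (p ?u)"
      by (auto simp: normal_table_def fun_eq_iff dists_def PiE_iff extensional_def)
    moreover have "p ?u > 0" using empty dists_pos by simp
    ultimately show ?case by metis
  next
    case (insert a A)
    then have a: "a \<in> cells k" "a \<noteq> ?u" by auto
    then have pa: "p a > 0" using insert.prems dists_pos by blast
    from move_factor_to_ones[OF a(1) pa] obtain d where d: "d > 0" and
      move: "\<And>q g. q \<in> dists k \<Longrightarrow> rescaling_invariant k g \<Longrightarrow>
               g (q(a := p a * q a)) = g (q(?u := d * q ?u))"
      by blast
    let ?q = "p(a := 1)"
    let ?r = "?q(?u := d * ?q ?u)"
    have q: "?q \<in> dists k" using insert.prems a by (intro dists_upd) auto
    have r: "?r \<in> dists k"
      using d by (intro dists_upd[OF q] mult_pos_pos dists_pos[OF q]) auto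
    have "\<exists>y>0. \<forall>g. rescaling_invariant k g \<longrightarrow> g ?r = g (normal_table k y)"
      using insert.prems by (intro insert.IH[OF _ _ r]) auto
    moreover have "g p = g ?r" if "rescaling_invariant k g" for g
      using move[OF q that] by simp
    ultimately show ?case by metis
  qed
  from this[of "cells k - {?u}" p] assms show ?thesis by auto
qed

section \<open>The log odds ratio\<close>

lemma LOR_eq_signed_sum: "LOR k p = (\<Sum>t\<in>cells k. (-1) ^ count_list t 2 * ln (p t))"
proof -
  have "(\<Sum>t\<in>cells k. (-1) ^ count_list t 2 * ln (p t)) =
        (\<Sum>t\<in>cells k. if even (count_list t 2) then ln (p t) else - ln (p t))"
    by (intro sum.cong) auto
  also have "\<dots> = LOR k p"
    by (simp add: sum.If_cases LOR_def even_cells_def odd_cells_def sum_negf Int_def)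
  finally show ?thesis ..
qed

lemma LOR_upd:
  assumes "t \<in> cells k"
  shows "LOR k (p(t := x)) = LOR k p + (-1) ^ count_list t 2 * (ln x - ln (p t))"
proof -
  have "(\<Sum>t'\<in>cells k - {t}. (-1) ^ count_list t' 2 * ln ((p(t := x)) t')) =
        (\<Sum>t'\<in>cells k - {t}. (-1) ^ count_list t' 2 * ln (p t'))"
    by (intro sum.cong) auto
  then show ?thesis
    using assms by (simp add: LOR_eq_signed_sum sum.remove algebra_simps)
qed

text \<open>Neighbouring cells have opposite signs, so that the two contributions of \<open>ln c\<close> cancel.\<close>
lemma LOR_rescaling_invariant: "rescaling_invariant k (LOR k)"
  unfolding rescaling_invariant_def
proof (intro ballI allI impI)
  fix p i s and c :: real
  assume p: "p \<in> dists k" and i: "i < k" and s: "s \<in> cells (k - 1)" and c: "c > 0"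
  have t: "ins i 1 s \<in> cells k" "ins i 2 s \<in> cells k"
    using ins_in_cells[OF i s] by auto
  have "ins i 1 s \<noteq> ins i 2 s"
    using ins_eq_iff[of s s i 1 2] i s by (auto simp: cells_def)
  then show "LOR k (p(ins i 1 s := c * p (ins i 1 s), ins i 2 s := c * p (ins i 2 s))) = LOR k p"
    using t c dists_pos[OF p t(1)] dists_pos[OF p t(2)]
    by (simp add: LOR_upd count_list_ins ln_mult)
qed

lemma LOR_normal_table: "LOR k (normal_table k y) = ln y"
proof -
  have "LOR k (\<lambda>t\<in>cells k. 1) = 0"
    by (simp add: LOR_eq_signed_sum)
  then show ?thesis
    by (simp add: normal_table_def LOR_upd)
qed

text \<open>
  The normal form is the constant table \<open>1\<close> with the entry at \<open>(1, \<dots>, 1)\<close> raised or lowered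
  to \<open>y\<close>.
\<close>
lemma property1_sgn_normal_table:
  assumes f: "property1 f" and k: "k \<ge> 1" and y: "y > 0"
  shows "sgn (f k (normal_table k y)) = sgn (ln y)"
proof -
  let ?u = "replicate k 1 :: nat list"
  have zero: "f k (normal_table k 1) = 0"
  proof -
    have "normal_table k 1 = (\<lambda>t\<in>cells k. 1)" by (auto simp: normal_table_def fun_eq_iff)
    then show ?thesis using f k unfolding property1_def by simp
  qed
  have mono: "f k (normal_table k a) < f k (normal_table k b)" if "0 < a" "a < b" for a b
  proof -
    have "normal_table k a \<in> dists k"
      unfolding normal_table_def using that by (intro dists_upd restrict_in_dists) auto
    moreover have "b > normal_table k a ?u" "(normal_table k a)(?u := b) = normal_table k b"
      using that by (auto simp: normal_table_def)
    ultimately show ?thesis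
      using f k unfolding property1_def by metis
  qed
  consider "y < 1" | "y = 1" | "y > 1" by linarith
  then show ?thesis
    using zero mono[of y 1] mono[of 1 y] y by cases auto
qed

lemma sgn_eq_sgn_LOR:
  assumes "property1 f" "property4 f" "k \<ge> 1" "p \<in> dists k"
  shows "sgn (f k p) = sgn (LOR k p)"
proof -
  from rescaling_normal_form[OF assms(4)] obtain y where y: "y > 0" and
    eq: "\<And>g. rescaling_invariant k g \<Longrightarrow> g p = g (normal_table k y)"
    by blast
  have "f k p = f k (normal_table k y)"
    using assms by (intro eq property4_imp_rescaling_invariant)
  moreover have "LOR k p = ln y"
    using eq[OF LOR_rescaling_invariant] by (simp add: LOR_normal_table)
  ultimately show ?thesis
    using property1_sgn_normal_table[OF assms(1,3) y] by simp
qed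

section \<open>Simpson's paradox\<close>

lemma cells_2: "cells 2 = {[1, 1], [1, 2], [2, 1], [2, 2]}"
  by (auto simp: cells_def numeral_2_eq_2 length_Suc_conv)

lemma LOR_2:
  "LOR 2 q = ln (q [1, 1]) + ln (q [2, 2]) - ln (q [1, 2]) - ln (q [2, 1])"
  by (simp add: LOR_eq_signed_sum cells_2)

lemma sgn_LOR_2:
  assumes "q \<in> dists 2"
  shows "sgn (LOR 2 q) = sgn (q [1, 1] * q [2, 2] - q [1, 2] * q [2, 1])"
proof -
  have pos: "q [1, 1] > 0" "q [1, 2] > 0" "q [2, 1] > 0" "q [2, 2] > 0"
    using assms by (auto intro: dists_pos simp: cells_2)
  then have "LOR 2 q = ln (q [1, 1] * q [2, 2]) - ln (q [1, 2] * q [2, 1])"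
    by (simp add: LOR_2 ln_mult)
  then show ?thesis
    using pos by (auto simp: sgn_real_def)
qed

text \<open>The variable that is summed out is the one numbered \<open>0\<close>.\<close>
definition simpson_table :: "nat list \<Rightarrow> real" where
  "simpson_table = (\<lambda>t\<in>cells 3.
     if t = [1, 1, 2] \<or> t = [2, 2, 1] then 8
     else if t = [1, 2, 1] \<or> t = [2, 1, 2] then 1
     else 3)"

lemma sgn_eq_sgn_LOR_imp_not_property3:
  assumes sgn: "\<And>q. q \<in> dists 2 \<Longrightarrow> sgn (f 2 q) = sgn (LOR 2 q)"
  shows "\<not> property3 f"
proof
  assume "property3 f"
  let ?p = simpson_table
  have p: "?p \<in> dists 3"
    unfolding simpson_table_def by (rule restrict_in_dists) auto
  have pos: "?p (ins 0 j s) > 0" if "s \<in> cells 2" "j \<in> {1, 2}" for s j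
    using that ins_in_cells[of 0 3 s j] dists_pos[OF p] by simp
  have slice: "slice_table 3 0 j ?p \<in> dists 2" if "j \<in> {1, 2}" for j
    unfolding slice_table_def using pos that by (auto intro!: restrict_in_dists)
  have marg: "marginal_table 3 0 ?p \<in> dists 2"
    unfolding marginal_table_def using pos by (auto intro!: restrict_in_dists add_pos_pos)
  note table_simps = sgn_LOR_2 slice_table_def marginal_table_def simpson_table_def ins_def
    cells_def
  have "sgn (f 2 (slice_table 3 0 1 ?p)) = 1" "sgn (f 2 (slice_table 3 0 2 ?p)) = 1"
    using slice by (simp_all add: sgn table_simps)
  moreover have "sgn (f 2 (marginal_table 3 0 ?p)) = -1"
    using marg by (simp add: sgn table_simps)
  moreover have "sgn (f 2 (marginal_table 3 0 ?p)) = sgn (f 2 (slice_table 3 0 1 ?p))"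
    if "sgn (f 2 (slice_table 3 0 1 ?p)) = sgn (f 2 (slice_table 3 0 2 ?p))"
    using \<open>property3 f\<close>[unfolded property3_def, rule_format, of 3 ?p 0] p that by simp
  ultimately show False by simp
qed

theorem theorem3:
  fixes f :: "nat \<Rightarrow> (nat list \<Rightarrow> real) \<Rightarrow> real"
  assumes "property1 f" and "property4 f"
  shows "(\<forall>k\<ge>1. \<forall>p\<in>dists k. sgn (f k p) = sgn (LOR k p)) \<and> \<not> property3 f"
  using sgn_eq_sgn_LOR[OF assms] sgn_eq_sgn_LOR_imp_not_property3[of f] by simp

end
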